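(* Let $r\ge 0$ be an integer, let $m_1,\dots,m_r$ be positive integers and put $m:=m_1+\cdots+m_r$. Let $n$ be a non-negative integer and let $b,c,d,e,f_1,\dots,f_r$ be complex numbers such that none of $c$, $e$, $f_1,\dots,f_r$ is a non-positive integer. Assume that $b\neq f_j$ for $1\le j\le r$, that $(c-b-m)_m\neq 0$, and that $\Re(e-d)>0$. Let $(\xi_m)=(\xi_1,\dots,\xi_m)$ be the (nonvanishing) zeros, counted with multiplicity, of the parametric polynomial $Q_m(t)$ associated with $b,c,(f_r),(m_r)$ (defined in the context). Then $$ {}_{r+3}F_{r+2}\left[\begin{array}{c} -n,\,b,\,d,\,f_1+m_1,\dots,f_r+m_r\\ c,\,e,\,f_1,\dots,f_r\end{array};1\right] =\frac{(e-d)_n}{(e)_n}\; {}_{m+3}F_{m+2}\left[\begin{array}{c} -n,\,c-b-m,\,d,\,\xi_1+1,\dots,\xi_m+1\\ c,\,1-e+d-n,\,\xi_1,\dots,\xi_m\end{array};1\right]. $$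
   Context: Pochhammer symbol: $(a)_0=1$, $(a)_n=a(a+1)\cdots(a+n-1)$ for $n\ge1$. The generalized hypergeometric series is $${}_pF_q\left[\begin{array}{c} a_1,\dots,a_p\\ b_1,\dots,b_q\end{array};x\right]=\sum_{k=0}^\infty\frac{(a_1)_k\cdots(a_p)_k}{(b_1)_k\cdots(b_q)_k}\frac{x^k}{k!};$$ with a numerator parameter $-n$ it is the finite sum over $0\le k\le n$. Coefficients $C_{k,r}$: let $\Lambda=(f_1)_{m_1}\cdots(f_r)_{m_r}$ (empty products equal $1$) and define $\sigma_0,\dots,\sigma_m$ by the polynomial identity $$(f_1+x)_{m_1}\cdots(f_r+x)_{m_r}=\sum_{j=0}^m\sigma_j x^j .$$ For $0\le k\le m$ put $$C_{k,r}=\frac1\Lambda\sum_{j=k}^m\sigma_j\,\mathbf S_j^{(k)},$$ where $\mathbf S_j^{(k)}$ are the Stirling numbers of the second kind (so $C_{0,r}=1$, $C_{m,r}=1/\Lambda$). Parametric polynomial: with $\lambda:=c-b-m$, $$Q_m(t)=\frac{1}{(\lambda)_m}\sum_{k=0}^m (b)_k\,C_{k,r}\,(t)_k\,(\lambda-t)_{m-k}.$$ One has $Q_m(0)=1$, so the zeros of $Q_m$ are nonzero and $Q_m(t)=\prod_j(1-t/\xi_j)$. Convention: in the series containing the parameter pairs $\xi_j+1$ (numerator) and $\xi_j$ (denominator), the ratio $(\xi_j+1)_k/(\xi_j)_k$ means $1+k/\xi_j$, so that the product of these ratios over all the zeros equals $Q_m(-k)$. (If $Q_m$ happens to have degree less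 than $m$, the product is over its zeros, and still equals $Q_m(-k)$.) *)

theory Defs
  imports
    "HOL-Analysis.Analysis"
    "HOL-Computational_Algebra.Computational_Algebra"
    "HOL-Combinatorics.Stirling"
    "HOL-Library.Nonpos_Ints"
begin

definition hypergeo :: "complex list \<Rightarrow> complex list \<Rightarrow> complex \<Rightarrow> complex" where
  "hypergeo as bs x = eval_fps (fps_hypergeo as bs 1) x"

lemma foldl_mult_pochhammer:
  fixes z :: complex
  shows "foldl (\<lambda>r a. r * pochhammer a k) z as = z * (\<Prod>a\<leftarrow>as. pochhammer a k)"
  by (induction as arbitrary: z) (simp_all add: mult.assoc)

lemma fps_hypergeo_nth_prod_list:
  fixes as bs :: "complex list"
  shows "fps_nth (fps_hypergeo as bs 1) k =
    (\<Prod>a\<leftarrow>as. pochhammer a k) / (\<Prod>b\<leftarrow>bs. pochhammer b k) / fact k"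
  by (simp add: foldl_mult_pochhammer)

lemma hypergeo_altdef:
  "hypergeo as bs x =
    (\<Sum>k. (\<Prod>a\<leftarrow>as. pochhammer a k) / (\<Prod>b\<leftarrow>bs. pochhammer b k) * x ^ k / fact k)"
  unfolding hypergeo_def eval_fps_def fps_hypergeo_nth_prod_list by simp

text \<open>
  The hypergeometric series with additional parameter pairs \<open>\<xi> + 1\<close> (numerator) and \<open>\<xi>\<close>
  (denominator) for \<open>\<xi>\<close> in \<open>xs\<close>. The ratio of the Pochhammer symbols of such a pair is read as
  \<open>1 + k / \<xi>\<close>, which remains meaningful when \<open>\<xi>\<close> is a negative integer.
\<close>
definition hypergeo_pairs ::
  "complex list \<Rightarrow> complex list \<Rightarrow> complex list \<Rightarrow> complex \<Rightarrow> complex" where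
  "hypergeo_pairs as bs xs x =
    (\<Sum>k. fps_nth (fps_hypergeo as bs 1) k * (\<Prod>\<xi>\<leftarrow>xs. 1 + of_nat k / \<xi>) * x ^ k)"

lemma pochhammer_pair_ratio:
  fixes z :: complex
  assumes "z \<notin> \<int>\<^sub>\<le>\<^sub>0"
  shows "pochhammer (z + 1) k / pochhammer z k = 1 + of_nat k / z"
proof -
  have nz: "z \<noteq> 0" "pochhammer z k \<noteq> 0"
    using assms by (auto simp: pochhammer_eq_0_iff)
  have "z * pochhammer (z + 1) k = pochhammer z k * (z + of_nat k)"
    using pochhammer_rec[of z k] pochhammer_Suc[of z k] by simp
  thus ?thesis
    using nz by (simp add: field_simps)
qed

lemma prod_list_pochhammer_pairs:
  assumes "set xs \<inter> \<int>\<^sub>\<le>\<^sub>0 = {}"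
  shows "(\<Prod>\<xi>\<leftarrow>xs. pochhammer (\<xi> + 1) k) / (\<Prod>\<xi>\<leftarrow>xs. pochhammer \<xi> k) =
    (\<Prod>\<xi>\<leftarrow>xs. 1 + of_nat k / (\<xi> :: complex))"
  using assms
proof (induction xs)
  case (Cons z xs)
  have "pochhammer (z + 1) k / pochhammer z k = 1 + of_nat k / z"
    using Cons.prems by (intro pochhammer_pair_ratio) auto
  moreover have "(\<Prod>\<xi>\<leftarrow>xs. pochhammer (\<xi> + 1) k) / (\<Prod>\<xi>\<leftarrow>xs. pochhammer \<xi> k) =
      (\<Prod>\<xi>\<leftarrow>xs. 1 + of_nat k / \<xi>)"
    using Cons by auto
  ultimately show ?case
    by (simp flip: times_divide_times_eq)
qed simp

lemma hypergeo_pairs_eq_hypergeo: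
  assumes "set xs \<inter> \<int>\<^sub>\<le>\<^sub>0 = {}"
  shows "hypergeo_pairs as bs xs x = hypergeo (as @ map (\<lambda>\<xi>. \<xi> + 1) xs) (bs @ xs) x"
  unfolding hypergeo_pairs_def hypergeo_def eval_fps_def fps_hypergeo_nth_prod_list
    prod_list_pochhammer_pairs[OF assms, symmetric]
  by (simp add: o_def mult_ac)

definition msum :: "nat \<Rightarrow> (nat \<Rightarrow> nat) \<Rightarrow> nat" where
  "msum r m = (\<Sum>j=1..r. m j)"

definition Lambda :: "nat \<Rightarrow> (nat \<Rightarrow> complex) \<Rightarrow> (nat \<Rightarrow> nat) \<Rightarrow> complex" where
  "Lambda r f m = (\<Prod>j=1..r. pochhammer (f j) (m j))"

text \<open>The coefficient of \<open>x ^ i\<close> in the product of the polynomials \<open>(f\<^sub>j + x)\<close>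
  raised to the rising power \<open>m\<^sub>j\<close>.\<close>
definition sigma :: "nat \<Rightarrow> (nat \<Rightarrow> complex) \<Rightarrow> (nat \<Rightarrow> nat) \<Rightarrow> nat \<Rightarrow> complex" where
  "sigma r f m i = coeff (\<Prod>j=1..r. pochhammer [:f j, 1:] (m j)) i"

definition C_coeff :: "nat \<Rightarrow> (nat \<Rightarrow> complex) \<Rightarrow> (nat \<Rightarrow> nat) \<Rightarrow> nat \<Rightarrow> complex" where
  "C_coeff r f m k =
    1 / Lambda r f m * (\<Sum>j=k..msum r m. sigma r f m j * of_nat (Stirling j k))"

definition Q_poly ::
  "complex \<Rightarrow> complex \<Rightarrow> nat \<Rightarrow> (nat \<Rightarrow> complex) \<Rightarrow> (nat \<Rightarrow> nat) \<Rightarrow> complex poly" where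
  "Q_poly b c r f m =
    (let M = msum r m; l = c - b - of_nat M in
      smult (1 / pochhammer l M)
        (\<Sum>k=0..M. smult (pochhammer b k * C_coeff r f m k)
          (pochhammer [:0, 1:] k * pochhammer [:l, -1:] (M - k))))"

lemma poly_pochhammer:
  fixes p :: "complex poly"
  shows "poly (pochhammer p k) t = pochhammer (poly p t) k"
  by (induction k) (simp_all add: pochhammer_Suc flip: of_nat_poly)

lemma poly_Q_poly:
  fixes b c t :: complex and r :: nat and f :: "nat \<Rightarrow> complex" and m :: "nat \<Rightarrow> nat"
  defines "l \<equiv> c - b - of_nat (msum r m)"
  shows "poly (Q_poly b c r f m) t = 1 / pochhammer l (msum r m) *
    (\<Sum>k=0..msum r m. pochhammer b k * C_coeff r f m k *
      pochhammer t k * pochhammer (l - t) (msum r m - k))"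
  unfolding Q_poly_def Let_def l_def
  by (simp add: poly_sum poly_pochhammer mult.assoc)

end

theory Submission
  imports Defs
begin

text \<open>
  Since \<open>(f\<^sub>j + m\<^sub>j)\<^sub>k / (f\<^sub>j)\<^sub>k = (f\<^sub>j + k)\<^sub>m / (f\<^sub>j)\<^sub>m\<close> with \<open>m = m\<^sub>j\<close>, the pairs on the left
  contribute a polynomial \<open>g(k)\<close>, whose coefficients in the basis of falling factorials
  are the \<open>C\<^sub>i\<close>. Applying the Chu--Vandermonde sum to each falling factorial separately gives
  \<open>(b)\<^sub>k g(k) / (c)\<^sub>k = (\<Sum>j\<le>k. (-1)\<^sup>j (k choose j) (\<lambda>)\<^sub>j Q(-j) / (c)\<^sub>j)\<close>.
  Substituting this into the left-hand side, exchanging the sums and evaluating the inner sum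
  over \<open>k\<close> by Chu--Vandermonde once more leaves the right-hand side.
\<close>

section \<open>Binomial sums, Chu-Vandermonde and reversal of Pochhammer symbols\<close>

text \<open>Trinomial revision followed by the shift j = i + l. The weight \<open>j choose i\<close>
  is thereby absorbed, leaving a plain binomial sum of length n - i that Chu-Vandermonde can
  evaluate.\<close>

lemma sum_choose_choose:
  fixes h :: "nat \<Rightarrow> 'a::comm_semiring_1"
  shows "(\<Sum>j\<le>n. of_nat (n choose j) * of_nat (j choose i) * h j) =
    of_nat (n choose i) * (\<Sum>l\<le>n-i. of_nat ((n - i) choose l) * h (i + l))"
proof (cases "i \<le> n")
  case True
  have "(\<Sum>j\<le>n. of_nat (n choose j) * of_nat (j choose i) * h j) =
      (\<Sum>j=i..n. of_nat (n choose j) * of_nat (j choose i) * h j)"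
    by (intro sum.mono_neutral_right) (auto simp: binomial_eq_0)
  also have "\<dots> = (\<Sum>j=i..n. of_nat (n choose i) * (of_nat ((n - i) choose (j - i)) * h j))"
  proof (rule sum.cong)
    fix j assume "j \<in> {i..n}"
    hence "of_nat (n choose j) * of_nat (j choose i) =
        (of_nat (n choose i) * of_nat ((n - i) choose (j - i)) :: 'a)"
      using choose_mult[of i j n] by (simp flip: of_nat_mult)
    thus "of_nat (n choose j) * of_nat (j choose i) * h j =
        of_nat (n choose i) * (of_nat ((n - i) choose (j - i)) * h j)"
      by (simp add: mult.assoc)
  qed simp
  also have "\<dots> = (\<Sum>l\<le>n-i. of_nat (n choose i) * (of_nat ((n - i) choose l) * h (i + l)))"
    by (rule sum.reindex_bij_witness[of _ "\<lambda>l. i + l" "\<lambda>j. j - i"]) (use True in auto)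
  finally show ?thesis
    by (simp add: sum_distrib_left)
next
  case False
  hence "(\<Sum>j\<le>n. of_nat (n choose j) * of_nat (j choose i) * h j) = 0"
    by (intro sum.neutral) (auto simp: binomial_eq_0)
  with False show ?thesis
    by (simp add: binomial_eq_0)
qed

lemma pochhammer_neg_of_nat:
  "pochhammer (- of_nat n :: 'a::field_char_0) k = (-1) ^ k * fact k * of_nat (n choose k)"
  by (simp add: binomial_gbinomial gbinomial_pochhammer field_simps flip: power_mult_distrib)

lemma chu_vandermonde:
  fixes a c :: "'a::field_char_0"
  assumes "c \<notin> \<int>\<^sub>\<le>\<^sub>0"
  shows "(\<Sum>k\<le>n. (-1) ^ k * of_nat (n choose k) * (pochhammer a k / pochhammer c k)) =
    pochhammer (c - a) n / pochhammer c n"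
proof -
  have "\<forall>i\<in>{0..<n}. c \<noteq> - of_nat i"
    using assms by auto
  from Vandermonde_pochhammer[OF this, of a] show ?thesis
    by (simp add: pochhammer_neg_of_nat atMost_atLeast0 field_simps)
qed

lemma add_of_nat_notin_nonpos_Ints:
  fixes z :: "'a::ring_char_0"
  assumes "z \<notin> \<int>\<^sub>\<le>\<^sub>0"
  shows "z + of_nat k \<notin> \<int>\<^sub>\<le>\<^sub>0"
proof
  assume "z + of_nat k \<in> \<int>\<^sub>\<le>\<^sub>0"
  then obtain j where "z + of_nat k = - of_nat j"
    by (auto elim: nonpos_Ints_cases')
  hence "z = - of_nat (j + k)"
    by (simp add: algebra_simps eq_neg_iff_add_eq_0)
  with assms show False
    by (metis minus_of_nat_in_nonpos_Ints)
qed

lemma pochhammer_nonzero_if_notin_nonpos_Ints: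
  fixes z :: "'a::field_char_0"
  assumes "z \<notin> \<int>\<^sub>\<le>\<^sub>0"
  shows "pochhammer z k \<noteq> 0"
  using assms by (auto simp: pochhammer_eq_0_iff)

text \<open>Once (d)_j / (e)_j is factored out, Chu-Vandermonde applies with d + j and e + j, whose
  difference is still e - d.\<close>

lemma chu_vandermonde_shifted:
  fixes d e :: "'a::field_char_0"
  assumes "e \<notin> \<int>\<^sub>\<le>\<^sub>0"
  shows "(\<Sum>l\<le>n. (-1) ^ l * of_nat (n choose l) *
      (pochhammer d (j + l) / pochhammer e (j + l))) =
    pochhammer d j * pochhammer (e - d) n / pochhammer e (j + n)"
proof -
  have "(\<Sum>l\<le>n. (-1) ^ l * of_nat (n choose l) *
      (pochhammer d (j + l) / pochhammer e (j + l))) =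
      pochhammer d j / pochhammer e j * (\<Sum>l\<le>n. (-1) ^ l * of_nat (n choose l) *
      (pochhammer (d + of_nat j) l / pochhammer (e + of_nat j) l))"
    by (simp add: sum_distrib_left pochhammer_product' mult_ac)
  also have "\<dots> = pochhammer d j * pochhammer (e - d) n / pochhammer e (j + n)"
    by (subst chu_vandermonde[OF add_of_nat_notin_nonpos_Ints[OF assms]])
      (simp add: pochhammer_product')
  finally show ?thesis .
qed

text \<open>The exchange of sums, stated for arbitrary sequences: the coefficient of
  \<open>v j\<close> is a sum over k that depends only on d and e, and
  \<open>sum_choose_choose\<close> reduces it to the shifted Chu-Vandermonde sum.\<close>

lemma alternating_binomial_transform:
  fixes d e :: "'a::field_char_0" and u v :: "nat \<Rightarrow> 'a"
  assumes "e \<notin> \<int>\<^sub>\<le>\<^sub>0"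
    and u: "\<And>k. u k = (\<Sum>j\<le>k. (-1) ^ j * of_nat (k choose j) * v j)"
  shows "(\<Sum>k\<le>n. (-1) ^ k * of_nat (n choose k) * (pochhammer d k / pochhammer e k) * u k) =
    (\<Sum>j\<le>n. of_nat (n choose j) * pochhammer d j * pochhammer (e - d) (n - j) * v j) /
      pochhammer e n"
proof -
  let ?h = "\<lambda>k. (-1) ^ k * (pochhammer d k / pochhammer e k)"
  \<comment> \<open>Padding with vanishing binomials makes the range of j independent of k, so that
    the sums can be swapped.\<close>
  have "u k = (\<Sum>j\<le>n. (-1) ^ j * of_nat (k choose j) * v j)" if "k \<le> n" for k
    unfolding u by (rule sum.mono_neutral_left) (use that in \<open>auto simp: binomial_eq_0\<close>)
  hence "(\<Sum>k\<le>n. (-1) ^ k * of_nat (n choose k) * (pochhammer d k / pochhammer e k) * u k) =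
      (\<Sum>k\<le>n. \<Sum>j\<le>n. (-1) ^ j * v j * (of_nat (n choose k) * of_nat (k choose j) * ?h k))"
    by (simp add: sum_distrib_left sum_divide_distrib mult_ac)
  also have "\<dots> = (\<Sum>j\<le>n. (-1) ^ j * v j *
      (\<Sum>k\<le>n. of_nat (n choose k) * of_nat (k choose j) * ?h k))"
    by (subst sum.swap) (simp add: sum_distrib_left)
  also have "\<dots> = (\<Sum>j\<le>n. of_nat (n choose j) * pochhammer d j *
      pochhammer (e - d) (n - j) * v j / pochhammer e n)"
  proof (rule sum.cong)
    fix j assume "j \<in> {..n}"
    have "(\<Sum>k\<le>n. of_nat (n choose k) * of_nat (k choose j) * ?h k) =
        of_nat (n choose j) * (\<Sum>l\<le>n-j. of_nat ((n - j) choose l) * ?h (j + l))"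
      by (rule sum_choose_choose)
    also have "\<dots> = of_nat (n choose j) * (-1) ^ j * (\<Sum>l\<le>n-j. (-1) ^ l *
        of_nat ((n - j) choose l) * (pochhammer d (j + l) / pochhammer e (j + l)))"
      by (simp add: sum_distrib_left power_add mult_ac)
    also have "\<dots> = of_nat (n choose j) * (-1) ^ j *
        (pochhammer d j * pochhammer (e - d) (n - j) / pochhammer e n)"
      using \<open>j \<in> {..n}\<close> by (subst chu_vandermonde_shifted[OF assms(1)]) simp
    finally show "(-1) ^ j * v j * (\<Sum>k\<le>n. of_nat (n choose k) * of_nat (k choose j) * ?h k) =
        of_nat (n choose j) * pochhammer d j * pochhammer (e - d) (n - j) * v j / pochhammer e n"
      by (simp add: mult_ac flip: power_mult_distrib)
  qed simp
  finally show ?thesis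
    by (simp add: sum_divide_distrib)
qed

text \<open>The last j factors of (z)_n, negated and read backwards, form (1 - z - n)_j.\<close>

lemma pochhammer_diff:
  fixes z :: "'a::field_char_0"
  assumes "j \<le> n" and "pochhammer (1 - z - of_nat n) j \<noteq> 0"
  shows "pochhammer z (n - j) = (-1) ^ j * pochhammer z n / pochhammer (1 - z - of_nat n) j"
proof -
  have "pochhammer z n = pochhammer z (n - j) * pochhammer (z + of_nat (n - j)) j"
    using assms(1) pochhammer_product'[of z "n - j" j] by simp
  also have "pochhammer (z + of_nat (n - j)) j = (-1) ^ j * pochhammer (1 - z - of_nat n) j"
    using pochhammer_minus'[of "z + of_nat n - 1" j] assms(1)
    by (simp add: of_nat_diff algebra_simps)
  finally show ?thesis
    using assms(2) by (simp flip: power_mult_distrib)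
qed

section \<open>Expansion in falling factorials\<close>

text \<open>The falling factorial n(n-1)...(n-i+1) is written as
  \<open>fact i * (n choose i)\<close>. Multiplying it by n = (n - i) + i yields the next falling
  factorial plus i times itself, which matches the Stirling recurrence.\<close>

lemma Stirling_power:
  "n ^ j = (\<Sum>i\<le>j. Stirling j i * (fact i * (n choose i)))"
proof (induction j)
  case (Suc j)
  have step: "n * (fact i * (n choose i)) =
      fact (Suc i) * (n choose Suc i) + i * (fact i * (n choose i))" for i
  proof (cases "i \<le> n")
    case True
    have "Suc i * (n choose Suc i) = (n - i) * (n choose i)"
      using binomial_absorb_comp[of n i] binomial_absorption[of i n] by simp
    hence "fact (Suc i) * (n choose Suc i) = (n - i) * (fact i * (n choose i))"
      by (metis fact_Suc mult.assoc mult.left_commute of_nat_id)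
    thus ?thesis
      using True by (metis add_mult_distrib le_add_diff_inverse2)
  qed (simp add: binomial_eq_0)
  have "n ^ Suc j = (\<Sum>i\<le>j. Stirling j i * (n * (fact i * (n choose i))))"
    by (simp add: Suc.IH sum_distrib_left mult_ac)
  also have "\<dots> = (\<Sum>i\<le>j. Stirling j i * (fact (Suc i) * (n choose Suc i))) +
      (\<Sum>i\<le>j. i * Stirling j i * (fact i * (n choose i)))"
    unfolding step by (simp add: algebra_simps sum.distrib)
  \<comment> \<open>The added term contains \<open>Stirling j (Suc j)\<close>, which is zero. The
    shift that follows drops the zero term at i = 0, so both sums end up over the same
    range.\<close>
  also have "(\<Sum>i\<le>j. i * Stirling j i * (fact i * (n choose i))) =
      (\<Sum>i\<le>Suc j. i * Stirling j i * (fact i * (n choose i)))"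
    by simp
  also have "\<dots> = (\<Sum>i\<le>j. Suc i * Stirling j (Suc i) * (fact (Suc i) * (n choose Suc i)))"
    by (subst sum.atMost_Suc_shift) simp
  also have "(\<Sum>i\<le>j. Stirling j i * (fact (Suc i) * (n choose Suc i))) + \<dots> =
      (\<Sum>i\<le>j. Stirling (Suc j) (Suc i) * (fact (Suc i) * (n choose Suc i)))"
    by (simp add: algebra_simps flip: sum.distrib)
  also have "\<dots> = (\<Sum>i\<le>Suc j. Stirling (Suc j) i * (fact i * (n choose i)))"
    by (subst sum.atMost_Suc_shift) simp
  finally show ?case .
qed simp

lemma degree_pochhammer_linear_le: "degree (pochhammer [:z, 1::complex:] n) \<le> n"
proof (induction n)
  case (Suc n)
  have "degree ([:z, 1:] + of_nat n) \<le> 1"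
    by (simp add: of_nat_poly)
  thus ?case
    using Suc degree_mult_le[of "pochhammer [:z, 1:] n" "[:z, 1:] + of_nat n"]
    by (simp add: pochhammer_Suc)
qed simp

text \<open>The degree of the product is at most \<open>msum r m\<close>, so truncating there loses
  no coefficient.\<close>

lemma prod_pochhammer_eq_sum_sigma:
  "(\<Prod>j=1..r. pochhammer (f j + x) (m j)) = (\<Sum>i\<le>msum r m. sigma r f m i * x ^ i)"
proof -
  let ?p = "\<Prod>j=1..r. pochhammer [:f j, 1:] (m j)"
  have "degree ?p \<le> (\<Sum>j=1..r. degree (pochhammer [:f j, 1:] (m j)))"
    using degree_prod_sum_le[of "{1..r}" "\<lambda>j. pochhammer [:f j, 1:] (m j)"] by (simp add: o_def)
  also have "\<dots> \<le> msum r m"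
    unfolding msum_def by (intro sum_mono degree_pochhammer_linear_le)
  finally have "(\<Sum>i\<le>msum r m. monom (coeff ?p i) i) = ?p"
    by (rule poly_as_sum_of_monoms')
  hence "poly ?p x = poly (\<Sum>i\<le>msum r m. monom (coeff ?p i) i) x"
    by simp
  thus ?thesis
    by (simp add: poly_prod poly_pochhammer poly_sum poly_monom sigma_def add_ac)
qed

text \<open>Stirling numbers change the monomial basis into falling factorials, so the
  \<open>C_coeff\<close> are the coordinates of the normalized product in that basis. Since
  \<open>Stirling j i\<close> vanishes for i > j, both indices may run up to
  \<open>msum r m\<close>.\<close>

lemma prod_pochhammer_eq_sum_C_coeff:
  assumes "Lambda r f m \<noteq> 0"
  shows "(\<Prod>j=1..r. pochhammer (f j + of_nat k) (m j)) =
    Lambda r f m * (\<Sum>i\<le>msum r m. C_coeff r f m i * (fact i * of_nat (k choose i)))"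
proof -
  let ?M = "msum r m" and ?b = "\<lambda>i. fact i * of_nat (k choose i) :: complex"
  have "of_nat k ^ j = (\<Sum>i\<le>?M. of_nat (Stirling j i) * ?b i)" if "j \<le> ?M" for j
  proof -
    have "of_nat k ^ j = (of_nat (\<Sum>i\<le>j. Stirling j i * (fact i * (k choose i))) :: complex)"
      by (simp only: Stirling_power flip: of_nat_power)
    also have "\<dots> = (\<Sum>i\<le>j. of_nat (Stirling j i) * ?b i)"
      by simp
    also have "\<dots> = (\<Sum>i\<le>?M. of_nat (Stirling j i) * ?b i)"
      by (rule sum.mono_neutral_left) (use that in auto)
    finally show ?thesis .
  qed
  hence "(\<Prod>j=1..r. pochhammer (f j + of_nat k) (m j)) =
      (\<Sum>j\<le>?M. \<Sum>i\<le>?M. sigma r f m j * of_nat (Stirling j i) * ?b i)"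
    unfolding prod_pochhammer_eq_sum_sigma by (simp add: sum_distrib_left mult.assoc)
  also have "\<dots> = (\<Sum>i\<le>?M. (\<Sum>j\<le>?M. sigma r f m j * of_nat (Stirling j i)) * ?b i)"
    by (subst sum.swap) (simp add: sum_distrib_right)
  also have "\<dots> = (\<Sum>i\<le>?M. Lambda r f m * (C_coeff r f m i * ?b i))"
  proof (rule sum.cong)
    fix i
    have "(\<Sum>j\<le>?M. sigma r f m j * of_nat (Stirling j i)) =
        (\<Sum>j=i..?M. sigma r f m j * of_nat (Stirling j i))"
      by (rule sum.mono_neutral_right) auto
    thus "(\<Sum>j\<le>?M. sigma r f m j * of_nat (Stirling j i)) * ?b i =
        Lambda r f m * (C_coeff r f m i * ?b i)"
      using assms by (simp add: C_coeff_def)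
  qed simp
  finally show ?thesis
    by (simp add: sum_distrib_left)
qed

section \<open>The connection formula between the two series\<close>

text \<open>The contribution of a single falling factorial to the connection formula: (-j)_i is a
  multiple of \<open>j choose i\<close>, so \<open>sum_choose_choose\<close> starts the sum at j = i
  and Chu-Vandermonde evaluates the rest.\<close>

lemma connection_term:
  fixes b c :: complex
  assumes c: "c \<notin> \<int>\<^sub>\<le>\<^sub>0" and "i \<le> M"
  defines "l \<equiv> c - b - of_nat M"
  shows "pochhammer b i * (\<Sum>j\<le>k. (-1) ^ j * of_nat (k choose j) *
      (pochhammer (- of_nat j) i * pochhammer l (j + (M - i)) / pochhammer c j)) =
    pochhammer l M * (fact i * of_nat (k choose i)) * (pochhammer b k / pochhammer c k)"
proof (cases "i \<le> k")
  case True
  let ?h = "\<lambda>j. (-1) ^ j * pochhammer l (j + (M - i)) / pochhammer c j"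
  have "(\<Sum>j\<le>k. (-1) ^ j * of_nat (k choose j) *
      (pochhammer (- of_nat j) i * pochhammer l (j + (M - i)) / pochhammer c j)) =
      (-1) ^ i * fact i * (\<Sum>j\<le>k. of_nat (k choose j) * of_nat (j choose i) * ?h j)"
    by (simp add: pochhammer_neg_of_nat sum_distrib_left mult_ac)
  also have "\<dots> = (-1) ^ i * fact i * of_nat (k choose i) *
      (\<Sum>q\<le>k-i. of_nat ((k - i) choose q) * ?h (i + q))"
    unfolding sum_choose_choose by (simp only: mult.assoc)
  also have "(\<Sum>q\<le>k-i. of_nat ((k - i) choose q) * ?h (i + q)) =
      (-1) ^ i * pochhammer l M / pochhammer c i *
      (\<Sum>q\<le>k-i. (-1) ^ q * of_nat ((k - i) choose q) *
        (pochhammer (c - b) q / pochhammer (c + of_nat i) q))"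
  proof -
    \<comment> \<open>The choice of \<open>l\<close> makes \<open>l\<close> + M equal to c - b, so
      all dependence on M moves into the constant (\<open>l\<close>)_M.\<close>
    have "pochhammer l (i + q + (M - i)) = pochhammer l M * pochhammer (c - b) q" for q
      using \<open>i \<le> M\<close> pochhammer_product'[of l M q] by (simp add: l_def add_ac)
    thus ?thesis
      by (simp add: sum_distrib_left pochhammer_product' power_add mult_ac)
  qed
  \<comment> \<open>The difference of parameters (c + i) - (c - b) is b + i, which later completes
    (b)_i to (b)_k.\<close>
  also have "\<dots> = (-1) ^ i * pochhammer l M / pochhammer c i *
      (pochhammer (b + of_nat i) (k - i) / pochhammer (c + of_nat i) (k - i))"
    by (subst chu_vandermonde[OF add_of_nat_notin_nonpos_Ints[OF c]]) (simp add: add_ac)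
  finally show ?thesis
    using True pochhammer_product[OF True, of b] pochhammer_product[OF True, of c]
    by (simp add: mult_ac flip: power_mult_distrib)
next
  case False
  \<comment> \<open>Here j \<le> k < i, so every (-j)_i contains a zero factor, and
    \<open>k choose i\<close> vanishes as well.\<close>
  thus ?thesis
    by (simp add: binomial_eq_0 pochhammer_of_nat_eq_0_lemma)
qed

text \<open>By linearity in the \<open>C_coeff\<close>, this is the weighted sum of the instances of
  \<open>connection_term\<close>. It puts the left-hand sequence into the form that
  \<open>alternating_binomial_transform\<close> expects.\<close>

lemma connection_Q_poly:
  fixes b c :: complex and r :: nat and m :: "nat \<Rightarrow> nat"
  defines "l \<equiv> c - b - of_nat (msum r m)"
  assumes c: "c \<notin> \<int>\<^sub>\<le>\<^sub>0" and l: "pochhammer l (msum r m) \<noteq> 0"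
    and Lambda: "Lambda r f m \<noteq> 0"
  shows "pochhammer b k / pochhammer c k *
      ((\<Prod>j=1..r. pochhammer (f j + of_nat k) (m j)) / Lambda r f m) =
    (\<Sum>j\<le>k. (-1) ^ j * of_nat (k choose j) *
      (pochhammer l j / pochhammer c j * poly (Q_poly b c r f m) (- of_nat j)))"
    (is "?lhs = ?rhs")
proof -
  let ?M = "msum r m" and ?C = "C_coeff r f m"
  \<comment> \<open>At t = -j the factor (\<open>l\<close> - t)_(M-i) becomes (\<open>l\<close> +
    j)_(M-i), which merges with (\<open>l\<close>)_j into one Pochhammer symbol.\<close>
  have Q: "pochhammer l j * poly (Q_poly b c r f m) (- of_nat j) =
      (\<Sum>i\<le>?M. ?C i * pochhammer b i / pochhammer l ?M *
        (pochhammer (- of_nat j) i * pochhammer l (j + (?M - i))))" for j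
    unfolding poly_Q_poly l_def[symmetric]
    by (simp add: sum_distrib_left pochhammer_product' atMost_atLeast0 mult_ac
        del: add_diff_assoc)
  have "?rhs = (\<Sum>j\<le>k. (-1) ^ j * of_nat (k choose j) / pochhammer c j *
      (pochhammer l j * poly (Q_poly b c r f m) (- of_nat j)))"
    by (simp add: mult_ac)
  also have "\<dots> = (\<Sum>j\<le>k. \<Sum>i\<le>?M. ?C i / pochhammer l ?M * (pochhammer b i *
      ((-1) ^ j * of_nat (k choose j) *
      (pochhammer (- of_nat j) i * pochhammer l (j + (?M - i)) / pochhammer c j))))"
    unfolding Q by (simp add: sum_distrib_left mult_ac)
  also have "\<dots> = (\<Sum>i\<le>?M. ?C i / pochhammer l ?M * (pochhammer b i *
      (\<Sum>j\<le>k. (-1) ^ j * of_nat (k choose j) *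
      (pochhammer (- of_nat j) i * pochhammer l (j + (?M - i)) / pochhammer c j))))"
    by (subst sum.swap) (simp add: sum_distrib_left)
  also have "\<dots> = (\<Sum>i\<le>?M. ?C i / pochhammer l ?M *
      (pochhammer l ?M * (fact i * of_nat (k choose i)) * (pochhammer b k / pochhammer c k)))"
    unfolding l_def by (intro sum.cong arg_cong2[where f = "(*)"] connection_term c) auto
  also have "\<dots> = (\<Sum>i\<le>?M. pochhammer b k / pochhammer c k *
      (?C i * (fact i * of_nat (k choose i))))"
    using l by (simp add: mult_ac)
  also have "\<dots> = ?lhs"
    unfolding prod_pochhammer_eq_sum_C_coeff[OF Lambda] using Lambda
    by (simp add: sum_distrib_left sum_divide_distrib)
  finally show ?thesis ..
qed

section \<open>Normalization and factorization of the parametric polynomial\<close>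

text \<open>Since (0)_k = 0 for k > 0, only the term k = 0 survives; the expansion in falling
  factorials, evaluated at 0, gives \<open>C_coeff r f m 0\<close> = 1.\<close>

lemma poly_Q_poly_0:
  assumes "pochhammer (c - b - of_nat (msum r m)) (msum r m) \<noteq> 0" and "Lambda r f m \<noteq> 0"
  shows "poly (Q_poly b c r f m) 0 = 1"
proof -
  let ?M = "msum r m"
  have "(\<Sum>i\<le>?M. C_coeff r f m i * (fact i * of_nat (0 choose i))) = C_coeff r f m 0"
    by (subst sum.atMost_shift) simp
  moreover have "Lambda r f m = (\<Prod>j=1..r. pochhammer (f j + of_nat 0) (m j))"
    by (simp add: Lambda_def)
  ultimately have C0: "C_coeff r f m 0 = 1"
    using assms(2) prod_pochhammer_eq_sum_C_coeff[OF assms(2), of 0] by simp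
  have "(\<Sum>k=0..?M. pochhammer b k * C_coeff r f m k * pochhammer 0 k *
      pochhammer (c - b - of_nat ?M - 0) (?M - k)) = pochhammer (c - b - of_nat ?M) ?M"
    by (subst sum.atLeast_Suc_atMost) (auto simp: C0 pochhammer_0_left intro!: sum.neutral)
  thus ?thesis
    using assms(1) by (simp add: poly_Q_poly)
qed

text \<open>Dividing the linear factorization at t by the one at 0 cancels the leading coefficient.
  The degree never enters, so a drop of the degree of \<open>Q_poly\<close> below
  \<open>msum r m\<close> is covered.\<close>

lemma prod_list_roots_eq_poly:
  fixes p :: "complex poly"
  assumes "mset xs = proots p" and p0: "poly p 0 = 1"
  shows "(\<Prod>\<xi>\<leftarrow>xs. 1 - t / \<xi>) = poly p t"
proof -
  have nz: "\<xi> \<noteq> 0" if "\<xi> \<in> set xs" for \<xi>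
  proof -
    have "p \<noteq> 0"
      using p0 by auto
    hence "poly p \<xi> = 0"
      using that assms(1) by (metis set_mset_mset set_count_proots mem_Collect_eq)
    thus ?thesis
      using p0 by auto
  qed
  have p: "poly p s = lead_coeff p * (\<Prod>\<xi>\<leftarrow>xs. s - \<xi>)" for s
  proof -
    have "p = smult (lead_coeff p) (\<Prod>\<xi>\<leftarrow>xs. [:-\<xi>, 1:])"
      by (metis assms(1) complex_poly_decompose_multiset mset_map prod_mset_prod_list)
    hence "poly p s = lead_coeff p * poly (\<Prod>\<xi>\<leftarrow>xs. [:-\<xi>, 1:]) s"
      by (metis poly_smult)
    moreover have "poly (\<Prod>\<xi>\<leftarrow>xs. [:-\<xi>, 1:]) s = (\<Prod>\<xi>\<leftarrow>xs. s - \<xi>)"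
      by (induction xs) (auto simp: algebra_simps)
    ultimately show ?thesis
      by simp
  qed
  have "(\<Prod>\<xi>\<leftarrow>xs. t - \<xi>) = (\<Prod>\<xi>\<leftarrow>xs. 1 - t / \<xi>) * (\<Prod>\<xi>\<leftarrow>xs. 0 - \<xi>)"
    using nz by (induction xs) (auto simp: field_simps)
  thus ?thesis
    using p[of t] p[of 0] p0 by simp
qed

section \<open>Parameter pairs and terminating series\<close>

text \<open>Both ratios come from splitting (f_j)_(m_j + k) after m_j or after k factors. The
  right-hand form is polynomial in k.\<close>

lemma prod_pochhammer_shift_ratio:
  fixes f :: "nat \<Rightarrow> complex"
  assumes "\<And>j. j \<in> {1..r} \<Longrightarrow> f j \<notin> \<int>\<^sub>\<le>\<^sub>0"
  shows "(\<Prod>j=1..r. pochhammer (f j + of_nat (m j)) k) / (\<Prod>j=1..r. pochhammer (f j) k) =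
    (\<Prod>j=1..r. pochhammer (f j + of_nat k) (m j)) / Lambda r f m"
proof -
  have "pochhammer (f j + of_nat (m j)) k / pochhammer (f j) k =
      pochhammer (f j + of_nat k) (m j) / pochhammer (f j) (m j)" if "j \<in> {1..r}" for j
    using pochhammer_nonzero_if_notin_nonpos_Ints[OF assms[OF that]]
      pochhammer_product'[of "f j" "m j" k] pochhammer_product'[of "f j" k "m j"]
    by (simp add: field_simps add.commute)
  thus ?thesis
    by (simp add: Lambda_def flip: prod_dividef)
qed

lemma prod_list_map_upt: "(\<Prod>j\<leftarrow>[1..<r+1]. g j) = (\<Prod>j=1..r. g j :: complex)"
  by (subst prod.distinct_set_conv_list[symmetric]) (auto intro!: prod.cong)

lemma hypergeo_terminating:
  "hypergeo (- of_nat n # as) bs 1 = (\<Sum>k\<le>n. (-1) ^ k * of_nat (n choose k) *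
    ((\<Prod>a\<leftarrow>as. pochhammer a k) / (\<Prod>b\<leftarrow>bs. pochhammer b k)))"
proof -
  have "hypergeo (- of_nat n # as) bs 1 = (\<Sum>k. (-1) ^ k * of_nat (n choose k) *
      ((\<Prod>a\<leftarrow>as. pochhammer a k) / (\<Prod>b\<leftarrow>bs. pochhammer b k)))"
    unfolding hypergeo_altdef by (simp add: pochhammer_neg_of_nat mult_ac)
  also have "\<dots> = (\<Sum>k\<le>n. (-1) ^ k * of_nat (n choose k) *
      ((\<Prod>a\<leftarrow>as. pochhammer a k) / (\<Prod>b\<leftarrow>bs. pochhammer b k)))"
    by (rule suminf_finite) (auto simp: binomial_eq_0)
  finally show ?thesis .
qed

lemma hypergeo_pairs_terminating:
  "hypergeo_pairs (- of_nat n # as) bs xs 1 = (\<Sum>k\<le>n. (-1) ^ k * of_nat (n choose k) *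
    ((\<Prod>a\<leftarrow>as. pochhammer a k) / (\<Prod>b\<leftarrow>bs. pochhammer b k)) *
    (\<Prod>\<xi>\<leftarrow>xs. 1 + of_nat k / \<xi>))"
proof -
  have "hypergeo_pairs (- of_nat n # as) bs xs 1 = (\<Sum>k. (-1) ^ k * of_nat (n choose k) *
      ((\<Prod>a\<leftarrow>as. pochhammer a k) / (\<Prod>b\<leftarrow>bs. pochhammer b k)) *
      (\<Prod>\<xi>\<leftarrow>xs. 1 + of_nat k / \<xi>))"
    unfolding hypergeo_pairs_def fps_hypergeo_nth_prod_list
    by (simp add: pochhammer_neg_of_nat mult_ac)
  also have "\<dots> = (\<Sum>k\<le>n. (-1) ^ k * of_nat (n choose k) *
      ((\<Prod>a\<leftarrow>as. pochhammer a k) / (\<Prod>b\<leftarrow>bs. pochhammer b k)) *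
      (\<Prod>\<xi>\<leftarrow>xs. 1 + of_nat k / \<xi>))"
    by (rule suminf_finite) (auto simp: binomial_eq_0)
  finally show ?thesis .
qed

section \<open>The transformation formula\<close>

theorem theorem3:
  fixes r n :: nat
    and m :: "nat \<Rightarrow> nat"
    and b c d e :: complex
    and f :: "nat \<Rightarrow> complex"
    and xs :: "complex list"
  assumes "\<And>j. j \<in> {1..r} \<Longrightarrow> m j > 0"
    and "c \<notin> \<int>\<^sub>\<le>\<^sub>0"
    and "e \<notin> \<int>\<^sub>\<le>\<^sub>0"
    and "\<And>j. j \<in> {1..r} \<Longrightarrow> f j \<notin> \<int>\<^sub>\<le>\<^sub>0"
    and "\<And>j. j \<in> {1..r} \<Longrightarrow> b \<noteq> f j"
    and "pochhammer (c - b - of_nat (msum r m)) (msum r m) \<noteq> 0"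
    and "Re (e - d) > 0"
    and "mset xs = proots (Q_poly b c r f m)"
  shows "hypergeo
           ([- of_nat n, b, d] @ map (\<lambda>j. f j + of_nat (m j)) [1..<r+1])
           ([c, e] @ map f [1..<r+1]) 1 =
         pochhammer (e - d) n / pochhammer e n *
         hypergeo_pairs
           [- of_nat n, c - b - of_nat (msum r m), d]
           [c, 1 - e + d - of_nat n] xs 1"
proof -
  let ?Q = "Q_poly b c r f m" and ?l = "c - b - of_nat (msum r m)"
  let ?g = "\<lambda>k. (\<Prod>j=1..r. pochhammer (f j + of_nat k) (m j)) / Lambda r f m"
  let ?u = "\<lambda>k. pochhammer b k / pochhammer c k * ?g k"
  let ?v = "\<lambda>j. pochhammer ?l j / pochhammer c j * poly ?Q (- of_nat j)"
  have Lambda: "Lambda r f m \<noteq> 0"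
    using assms(4) by (simp add: Lambda_def pochhammer_nonzero_if_notin_nonpos_Ints)
  have Q: "(\<Prod>\<xi>\<leftarrow>xs. 1 + of_nat k / \<xi>) = poly ?Q (- of_nat k)" for k
    using prod_list_roots_eq_poly[OF assms(8) poly_Q_poly_0[OF assms(6) Lambda], of "- of_nat k"]
    by simp
  \<comment> \<open>A zero of the denominator would give e - d = 1 - n + i with i < j \<le> n, hence
    a nonpositive real part, against Re (e - d) > 0.\<close>
  have reflect: "pochhammer (e - d) (n - j) =
      (-1) ^ j * pochhammer (e - d) n / pochhammer (1 - e + d - of_nat n) j" if "j \<le> n" for j
  proof -
    have "pochhammer (1 - (e - d) - of_nat n) j \<noteq> 0"
    proof
      assume "pochhammer (1 - (e - d) - of_nat n) j = 0"
      then obtain i where "i < j" and "1 - (e - d) - of_nat n = - of_nat i"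
        by (auto simp: pochhammer_eq_0_iff)
      hence "Re (1 - (e - d) - of_nat n) = Re (- of_nat i)"
        by simp
      with \<open>i < j\<close> that assms(7) show False
        by simp
    qed
    from pochhammer_diff[OF that this] show ?thesis
      by (simp add: algebra_simps)
  qed
  have "hypergeo ([- of_nat n, b, d] @ map (\<lambda>j. f j + of_nat (m j)) [1..<r+1])
      ([c, e] @ map f [1..<r+1]) 1 =
      (\<Sum>k\<le>n. (-1) ^ k * of_nat (n choose k) * (pochhammer d k / pochhammer e k) * ?u k)"
    unfolding append_Cons hypergeo_terminating
  proof (intro sum.cong refl)
    fix k
    have "(\<Prod>a\<leftarrow>b # d # [] @ map (\<lambda>j. f j + of_nat (m j)) [1..<r+1]. pochhammer a k) /
        (\<Prod>a\<leftarrow>c # e # [] @ map f [1..<r+1]. pochhammer a k) =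
        pochhammer b k * pochhammer d k / (pochhammer c k * pochhammer e k) *
        ((\<Prod>j=1..r. pochhammer (f j + of_nat (m j)) k) / (\<Prod>j=1..r. pochhammer (f j) k))"
      using prod_list_map_upt[of "\<lambda>j. pochhammer (f j + of_nat (m j)) k" r]
        prod_list_map_upt[of "\<lambda>j. pochhammer (f j) k" r]
      by (simp add: o_def mult_ac del: upt_Suc)
    also have "\<dots> = pochhammer d k / pochhammer e k * ?u k"
      by (simp only: prod_pochhammer_shift_ratio[OF assms(4)]) (simp add: mult_ac)
    finally show "(-1) ^ k * of_nat (n choose k) *
        ((\<Prod>a\<leftarrow>b # d # [] @ map (\<lambda>j. f j + of_nat (m j)) [1..<r+1]. pochhammer a k) /
        (\<Prod>a\<leftarrow>c # e # [] @ map f [1..<r+1]. pochhammer a k)) =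
        (-1) ^ k * of_nat (n choose k) * (pochhammer d k / pochhammer e k) * ?u k"
      by (simp only: mult.assoc)
  qed
  also have "\<dots> = (\<Sum>j\<le>n. of_nat (n choose j) * pochhammer d j *
      pochhammer (e - d) (n - j) * ?v j) / pochhammer e n"
    by (rule alternating_binomial_transform[OF assms(3)])
      (rule connection_Q_poly[OF assms(2) assms(6) Lambda])
  \<comment> \<open>Reversing (e - d)_(n-j) supplies the sign (-1)^j, the denominator parameter 1 -
    e + d - n and the prefactor; \<open>Q\<close> turns the values of the polynomial into the root
    pairs.\<close>
  also have "\<dots> = pochhammer (e - d) n / pochhammer e n *
      hypergeo_pairs [- of_nat n, ?l, d] [c, 1 - e + d - of_nat n] xs 1"
    unfolding hypergeo_pairs_terminating Q
    by (simp add: reflect sum_distrib_left sum_divide_distrib mult_ac)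
  finally show ?thesis .
qed

end
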